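(* Let $K\subset\mathbb{R}^n$ be a convex body containing the origin in its interior, let $f:\mathbb{S}^{n-1}\to\mathbb{R}$ be continuous, and let $K_t=W(h_K+tf)$ be the corresponding perturbation of $K$, defined for $t$ in an open interval around $0$ on which $h_K+tf>0$ on $\mathbb{S}^{n-1}$. Then for $S_K$-almost every $u\in\mathbb{S}^{n-1}$ the function $t\mapsto h_{K_t}(u)$ is differentiable at $t=0$ and $$\frac{d\,h_{K_t}(u)}{dt}\Big|_{t=0}=f(u).$$
   Context: A convex body is a convex compact set with non-empty interior. $\mathbb{S}^{n-1}$ is the unit sphere in $\mathbb{R}^n$ and $\langle\cdot,\cdot\rangle$ the inner product. The support function of $K$ is $h_K(u)=\max\{\langle x,u\rangle: x\in K\}$, $u\in\mathbb{S}^{n-1}$. The Wulff shape of a non-negative function $g:\mathbb{S}^{n-1}\to\mathbb{R}$ is $W(g)=\bigcap_{u\in\mathbb{S}^{n-1}}\{x\in\mathbb{R}^n:\langle x,u\rangle\le g(u)\}$. The surface area measure $S_K$ of $K$ is the Borel measure on $\mathbb{S}^{n-1}$ given by $S_K(\Omega)=\mathcal{H}^{n-1}\big(\{x\in\partial K:\exists u\in\Omega,\ \langle x,u\rangle=h_K(u)\}\big)$, where $\mathcal{H}^{n-1}$ is $(n-1)$-dimensional Hausdorff measure. *)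

theory Defs
  imports "HOL-Analysis.Analysis"
begin

definition convex_body :: "'a::euclidean_space set \<Rightarrow> bool" where
  "convex_body K \<longleftrightarrow> convex K \<and> compact K \<and> interior K \<noteq> {}"

text \<open>For nonempty compact \<open>K\<close> the supremum is attained, so it is the maximum.\<close>

definition support_function :: "'a::euclidean_space set \<Rightarrow> 'a \<Rightarrow> real" where
  "support_function K u = (SUP x\<in>K. x \<bullet> u)"

definition wulff_shape :: "('a::euclidean_space \<Rightarrow> real) \<Rightarrow> 'a set" where
  "wulff_shape g = (\<Inter>u\<in>sphere 0 1. {x. x \<bullet> u \<le> g u})"

text \<open>
  The \<open>m\<close>-dimensional Hausdorff measure, as an outer measure on all subsets, normalised so that
  for \<open>m = DIM('a)\<close> it agrees with Lebesgue measure. Two conventions matter. The empty set costs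
  \<open>0\<close> also for \<open>m = 0\<close>, where \<open>0 ^ 0 = 1\<close>, so that the case \<open>m = 0\<close> is the counting measure.
  Covering sets are required to be bounded because \<open>diameter\<close> is unspecified on unbounded sets.
\<close>

definition hausdorff_weight :: "nat \<Rightarrow> 'a::euclidean_space set \<Rightarrow> ennreal" where
  "hausdorff_weight m U =
     (if U = {} then 0 else ennreal (unit_ball_vol (real m) * (diameter U / 2) ^ m))"

definition hausdorff_premeasure :: "nat \<Rightarrow> real \<Rightarrow> 'a::euclidean_space set \<Rightarrow> ennreal" where
  "hausdorff_premeasure m \<delta> A =
     (INF U \<in> {U :: nat \<Rightarrow> 'a set. A \<subseteq> (\<Union>i. U i) \<and> (\<forall>i. bounded (U i) \<and> diameter (U i) \<le> \<delta>)}.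
        \<Sum>i. hausdorff_weight m (U i))"

definition hausdorff_measure :: "nat \<Rightarrow> 'a::euclidean_space set \<Rightarrow> ennreal" where
  "hausdorff_measure m A = (SUP \<delta>\<in>{0<..}. hausdorff_premeasure m \<delta> A)"

definition reverse_spherical_image :: "'a::euclidean_space set \<Rightarrow> 'a set \<Rightarrow> 'a set" where
  "reverse_spherical_image K \<Omega> =
     {x \<in> frontier K. \<exists>u\<in>\<Omega>. x \<bullet> u = support_function K u}"

text \<open>
  \<open>measure_of\<close> returns the given set function only if that function is a measure on the Borel sets
  of the sphere. For a convex body it is: the boundary points with more than one unit outer normal
  form a set of \<open>(n - 1)\<close>-dimensional Hausdorff measure zero, so disjoint Borel sets of normals have
  Hausdorff-measurable reverse spherical images that overlap only in a null set.
\<close>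

definition surface_area_measure :: "'a::euclidean_space set \<Rightarrow> 'a measure" where
  "surface_area_measure K =
     measure_of (sphere 0 1) (sets (restrict_space borel (sphere 0 1)))
       (\<lambda>\<Omega>. hausdorff_measure (DIM('a) - 1) (reverse_spherical_image K \<Omega>))"

lemma space_surface_area_measure [simp]: "space (surface_area_measure K) = sphere 0 1"
  unfolding surface_area_measure_def
  by (rule space_measure_of) (auto simp: sets_restrict_space)

lemma sets_surface_area_measure [simp]:
  "sets (surface_area_measure K) = sets (restrict_space borel (sphere 0 1))"
proof -
  have "sets (surface_area_measure K) =
      sigma_sets (sphere 0 1) (sets (restrict_space borel (sphere 0 1)))"
    unfolding surface_area_measure_def
    by (rule sets_measure_of) (auto simp: sets_restrict_space)
  also have "\<dots> = sets (restrict_space borel (sphere 0 1))"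
    using sets.sigma_sets_eq[of "restrict_space borel (sphere (0::'a) 1)"]
    by (simp add: space_restrict_space)
  finally show ?thesis .
qed

end

theory Submission
  imports Defs
begin

text \<open>
  Fix a unit vector \<open>u\<close>, put \<open>g\<^sub>t = h\<^sub>K + t f\<close> and \<open>K\<^sub>t = W(g\<^sub>t)\<close>. The bound
  \<open>h(K\<^sub>t, u) \<le> g\<^sub>t u\<close> is built into the Wulff shape. For the converse, suppose that some boundary
  point \<open>x\<close> of \<open>K\<close> has \<open>u\<close> as its only outer unit normal. Then \<open>x + (t f(u) - e \<bar>t\<bar>) u\<close> lies in
  \<open>K\<^sub>t\<close> for all small \<open>t\<close>: for directions \<open>v\<close> close to \<open>u\<close> the term \<open>e \<bar>t\<bar>\<close> absorbs the oscillation
  of \<open>f\<close>, and for the other directions \<open>h\<^sub>K(v) - x \<bullet> v\<close> is bounded away from \<open>0\<close> by compactness. Hence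
  \<open>h(K\<^sub>t, u) \<ge> g\<^sub>t u - e \<bar>t\<bar>\<close>, which gives the derivative
  (\<open>has_derivative_support_wulff_at_regular_normal\<close>).

  So a direction \<open>u\<close> at which the derivative fails is a normal only at points that have a second unit
  normal, and it remains to see that these singular points form a set of \<open>(n-1)\<close>-dimensional
  Hausdorff measure zero (\<open>hausdorff_null_singular_points\<close>). Two unit normals \<open>u1\<close>, \<open>u2\<close> at a
  point \<open>x\<close> are linearly independent because \<open>K\<close> has interior points, and the nearest
  point map \<open>p\<close> of \<open>K\<close> sends the whole two-dimensional piece
  \<open>{x + \<alpha> u1 + \<beta> u2 | \<alpha>, \<beta> > 0}\<close> to \<open>x\<close>. Its projection to some pair of coordinates is open, so it
  meets one of countably many \<open>(n-2)\<close>-dimensional coordinate planes. The singular points are thus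
  covered by the images under \<open>p\<close> of these planes, and \<open>p\<close> does not increase distances.

  Finally the set of exceptional directions is Borel, because it is built by countable operations
  from sets that are closed by continuity of support functions. As the value of a \<open>measure_of\<close> on a
  measurable set is either the prescribed one or \<open>0\<close>, the surface area measure of this set vanishes.
\<close>

section \<open>Null sets of Hausdorff measure\<close>

lemma hausdorff_measure_eq_0_iff:
  "hausdorff_measure m A = 0 \<longleftrightarrow> (\<forall>\<delta>>0. hausdorff_premeasure m \<delta> A = 0)"
  by (auto simp: hausdorff_measure_def SUP_eq_iff bot_ennreal[symmetric])

lemma hausdorff_premeasure_mono:
  "A \<subseteq> B \<Longrightarrow> hausdorff_premeasure m \<delta> A \<le> hausdorff_premeasure m \<delta> B"
  unfolding hausdorff_premeasure_def by (rule INF_superset_mono) auto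

lemma hausdorff_null_subset:
  "A \<subseteq> B \<Longrightarrow> hausdorff_measure m B = 0 \<Longrightarrow> hausdorff_measure m A = 0"
  unfolding hausdorff_measure_eq_0_iff using hausdorff_premeasure_mono
  by (metis le_zero_eq)

lemma hausdorff_premeasure_le_suminf:
  assumes "A \<subseteq> (\<Union>i. U i)" "\<And>i. bounded (U i)" "\<And>i. diameter (U i) \<le> \<delta>"
  shows "hausdorff_premeasure m \<delta> A \<le> (\<Sum>i. hausdorff_weight m (U i))"
  unfolding hausdorff_premeasure_def by (rule INF_lower) (simp add: assms)

lemma hausdorff_premeasure_le_finite_sum:
  assumes "finite I" "A \<subseteq> (\<Union>i\<in>I. U i)" "\<delta> \<ge> 0"
    and "\<And>i. i \<in> I \<Longrightarrow> bounded (U i) \<and> diameter (U i) \<le> \<delta>"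
  shows "hausdorff_premeasure m \<delta> A \<le> (\<Sum>i\<in>I. hausdorff_weight m (U i))"
proof -
  obtain e where e: "bij_betw e {..<card I} I"
    using ex_bij_betw_nat_finite[OF \<open>finite I\<close>] by (auto simp: atLeast0LessThan)
  define V where "V k = (if k < card I then U (e k) else {})" for k
  have eI: "e k \<in> I" if "k < card I" for k
    using e that by (auto simp: bij_betw_def)
  have "A \<subseteq> (\<Union>k. V k)"
  proof
    fix x assume "x \<in> A"
    then obtain i where i: "i \<in> I" "x \<in> U i" using assms(2) by auto
    then obtain k where "k < card I" "e k = i" using e unfolding bij_betw_def by force
    then show "x \<in> (\<Union>k. V k)" using i by (auto simp: V_def intro!: exI[of _ k])
  qed
  moreover have "bounded (V k) \<and> diameter (V k) \<le> \<delta>" for k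
    using assms(3,4) eI by (auto simp: V_def)
  ultimately have "hausdorff_premeasure m \<delta> A \<le> (\<Sum>k. hausdorff_weight m (V k))"
    by (intro hausdorff_premeasure_le_suminf) auto
  also have "\<dots> = (\<Sum>k<card I. hausdorff_weight m (V k))"
    by (intro suminf_finite) (auto simp: V_def hausdorff_weight_def)
  also have "\<dots> = (\<Sum>k<card I. hausdorff_weight m (U (e k)))"
    by (simp add: V_def)
  also have "\<dots> = (\<Sum>i\<in>I. hausdorff_weight m (U i))"
    by (rule sum.reindex_bij_betw[OF e])
  finally show ?thesis .
qed

lemma hausdorff_null_UN_nat:
  fixes A :: "nat \<Rightarrow> 'a::euclidean_space set"
  assumes "\<And>k. hausdorff_measure m (A k) = 0"
  shows "hausdorff_measure m (\<Union>k. A k) = 0"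
  unfolding hausdorff_measure_eq_0_iff
proof (intro allI impI)
  fix \<delta> :: real assume "\<delta> > 0"
  have "hausdorff_premeasure m \<delta> (\<Union>k. A k) \<le> 0 + ennreal e" if "e > 0" for e :: real
  proof -
    have "\<exists>U. A k \<subseteq> (\<Union>i. U i) \<and> (\<forall>i. bounded (U i) \<and> diameter (U i) \<le> \<delta>) \<and>
            (\<Sum>i. hausdorff_weight m (U i)) < ennreal (e * (1/2) ^ Suc k)" for k
    proof -
      have "hausdorff_premeasure m \<delta> (A k) < ennreal (e * (1/2) ^ Suc k)"
        using assms[of k] \<open>\<delta> > 0\<close> \<open>e > 0\<close> by (simp add: hausdorff_measure_eq_0_iff)
      then show ?thesis
        unfolding hausdorff_premeasure_def INF_less_iff by auto
    qed
    then obtain U where U: "\<And>k. A k \<subseteq> (\<Union>i. U k i)"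
      "\<And>k i. bounded (U k i) \<and> diameter (U k i) \<le> \<delta>"
      "\<And>k. (\<Sum>i. hausdorff_weight m (U k i)) < ennreal (e * (1/2) ^ Suc k)"
      by metis
    define V where "V j = case_prod U (prod_decode j)" for j
    have "(\<Union>k. A k) \<subseteq> (\<Union>j. V j)"
    proof
      fix x assume "x \<in> (\<Union>k. A k)"
      then obtain k i where "x \<in> U k i" using U(1) by blast
      then show "x \<in> (\<Union>j. V j)" by (auto simp: V_def intro!: exI[of _ "prod_encode (k, i)"])
    qed
    moreover have "bounded (V j) \<and> diameter (V j) \<le> \<delta>" for j
      using U(2) by (auto simp: V_def split: prod.split)
    ultimately have "hausdorff_premeasure m \<delta> (\<Union>k. A k) \<le> (\<Sum>j. hausdorff_weight m (V j))"
      by (intro hausdorff_premeasure_le_suminf) auto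
    also have "\<dots> = (\<Sum>j. (\<lambda>(k, i). hausdorff_weight m (U k i)) (prod_decode j))"
      by (simp add: V_def split_beta)
    also have "\<dots> = (\<Sum>k. \<Sum>i. hausdorff_weight m (U k i))"
      by (subst suminf_ennreal_2dimen[symmetric]) (auto simp: comp_def)
    also have "\<dots> \<le> (\<Sum>k. ennreal (e * (1/2) ^ Suc k))"
      using U(3) by (intro suminf_le) (auto intro: less_imp_le)
    also have "\<dots> = ennreal e"
      using \<open>e > 0\<close> sums_mult[OF power_half_series, of e]
      by (intro suminf_ennreal_eq) auto
    finally show ?thesis by simp
  qed
  then have "hausdorff_premeasure m \<delta> (\<Union>k. A k) \<le> 0"
    by (rule ennreal_le_epsilon)
  then show "hausdorff_premeasure m \<delta> (\<Union>k. A k) = 0" by simp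
qed

lemma hausdorff_null_UN:
  fixes A :: "'i \<Rightarrow> 'a::euclidean_space set"
  assumes "countable I" "\<And>i. i \<in> I \<Longrightarrow> hausdorff_measure m (A i) = 0"
  shows "hausdorff_measure m (\<Union>i\<in>I. A i) = 0"
proof (cases "I = {}")
  case True
  have "hausdorff_premeasure m \<delta> ({} :: 'a set) = 0" if "\<delta> > 0" for \<delta>
    using hausdorff_premeasure_le_finite_sum[of "{}" "{}" "\<lambda>_. {}" \<delta> m] that by simp
  then show ?thesis using True by (simp add: hausdorff_measure_eq_0_iff)
next
  case False
  then have "(\<Union>i\<in>I. A i) = (\<Union>k. A (from_nat_into I k))"
    using assms(1) by (metis UN_extend_simps(10) range_from_nat_into)
  then show ?thesis
    using assms(2) False by (simp add: hausdorff_null_UN_nat from_nat_into)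
qed

text \<open>The image of a cover is a cover whose pieces have no larger diameters.\<close>

lemma hausdorff_null_nonexpansive_image:
  fixes p :: "'a::euclidean_space \<Rightarrow> 'b::euclidean_space"
  assumes p: "\<And>x y. dist (p x) (p y) \<le> dist x y"
    and "hausdorff_measure m A = 0"
  shows "hausdorff_measure m (p ` A) = 0"
proof -
  have bounded: "bounded (p ` U)" and diam: "diameter (p ` U) \<le> diameter U" if "bounded U" for U
  proof -
    have *: "dist (p x) (p y) \<le> diameter U" if "x \<in> U" "y \<in> U" for x y
      using p[of x y] diameter_bounded_bound[OF \<open>bounded U\<close> that] by linarith
    show "bounded (p ` U)"
      unfolding bounded_two_points by (intro exI[of _ "diameter U"]) (simp add: *)
    show "diameter (p ` U) \<le> diameter U"
      using diameter_ge_0[OF that] by (intro diameter_le) (auto simp: * dist_norm[symmetric])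
  qed
  have weight: "hausdorff_weight m (p ` U) \<le> hausdorff_weight m U" if "bounded U" for U
  proof -
    have "(diameter (p ` U) / 2) ^ m \<le> (diameter U / 2) ^ m"
      using diam[OF that] diameter_ge_0[OF bounded[OF that]] by (intro power_mono) auto
    then have "unit_ball_vol (real m) * (diameter (p ` U) / 2) ^ m
        \<le> unit_ball_vol (real m) * (diameter U / 2) ^ m"
      by (rule mult_left_mono) simp
    then show ?thesis by (auto simp: hausdorff_weight_def intro: ennreal_leI)
  qed
  have le: "hausdorff_premeasure m \<delta> (p ` A) \<le> hausdorff_premeasure m \<delta> A" for \<delta>
    unfolding hausdorff_premeasure_def[of m \<delta> A]
  proof (rule INF_greatest)
    fix U assume "U \<in> {U :: nat \<Rightarrow> 'a set. A \<subseteq> (\<Union>i. U i) \<and>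
        (\<forall>i. bounded (U i) \<and> diameter (U i) \<le> \<delta>)}"
    then have A: "A \<subseteq> (\<Union>i. U i)" and U: "bounded (U i)" "diameter (U i) \<le> \<delta>" for i
      by simp_all
    have "hausdorff_premeasure m \<delta> (p ` A) \<le> (\<Sum>i. hausdorff_weight m (p ` U i))"
    proof (rule hausdorff_premeasure_le_suminf)
      show "p ` A \<subseteq> (\<Union>i. p ` U i)"
        using image_mono[OF A, of p] unfolding image_UN .
      fix i
      show "bounded (p ` U i)" by (rule bounded[OF U(1)])
      show "diameter (p ` U i) \<le> \<delta>" by (rule order_trans[OF diam[OF U(1)] U(2)])
    qed
    also have "\<dots> \<le> (\<Sum>i. hausdorff_weight m (U i))"
      by (rule suminf_le[OF weight[OF U(1)] summableI summableI])
    finally show "hausdorff_premeasure m \<delta> (p ` A) \<le> (\<Sum>i. hausdorff_weight m (U i))" .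
  qed
  show ?thesis
    unfolding hausdorff_measure_eq_0_iff
  proof (intro allI impI)
    fix \<delta> :: real assume "\<delta> > 0"
    then have "hausdorff_premeasure m \<delta> A = 0"
      using assms(2) by (simp add: hausdorff_measure_eq_0_iff)
    with le[of \<delta>] show "hausdorff_premeasure m \<delta> (p ` A) = 0" by simp
  qed
qed

section \<open>Coordinate planes of codimension two\<close>

text \<open>
  Inside a cube of side \<open>2 R\<close> the plane meets about \<open>(2 R M)^(n-2)\<close> cells of a grid of mesh \<open>1/M\<close>,
  each of which weighs a constant times \<open>M^-(n-1)\<close>. The total tends to \<open>0\<close> as \<open>M\<close> grows.
\<close>

lemma hausdorff_null_bounded_codim_2:
  fixes i j :: "'n::finite" and R :: nat
  assumes "i \<noteq> j"
  shows "hausdorff_measure (CARD('n) - 1)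
    {y :: real ^ 'n. y $ i = r \<and> y $ j = s \<and> (\<forall>k. \<bar>y $ k\<bar> \<le> real R)} = 0"
    (is "hausdorff_measure ?m ?L = 0")
  unfolding hausdorff_measure_eq_0_iff
proof (intro allI impI)
  fix \<delta> :: real assume "\<delta> > 0"
  define n where "n = CARD('n)"
  have card2: "card {i, j} = 2" using assms by simp
  have "card {i, j} \<le> n" unfolding n_def by (rule card_mono) auto
  then have n2: "n \<ge> 2" using card2 by simp
  define c where "c = unit_ball_vol (real ?m) * (real n / 2) ^ (n - 1) * real (2 * R + 1) ^ (n - 2)"
  have "c \<ge> 0" by (simp add: c_def less_imp_le[OF unit_ball_vol_pos])
  have key: "hausdorff_premeasure ?m \<delta> ?L \<le> ennreal (c / real M)"
    if M: "M \<ge> 1" "real n / real M \<le> \<delta>" for M :: nat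
  proof -
    define J where "J = UNIV - {i, j}"
    define I where "I = Pi\<^sub>E J (\<lambda>_. {- int (R * M) .. int (R * M)})"
    define cell where
      "cell g = {y :: real ^ 'n. y $ i = r \<and> y $ j = s \<and> (\<forall>k\<in>J. \<lfloor>real M * y $ k\<rfloor> = g k)}" for g
    have "finite I" unfolding I_def by (rule finite_PiE) (auto simp: J_def)
    have cardJ: "card J = n - 2"
      using card2 by (simp add: J_def n_def card_Diff_subset)
    have cardI: "card I = (2 * R * M + 1) ^ (n - 2)"
      unfolding I_def by (subst card_PiE) (auto simp: J_def[symmetric] cardJ nat_add_distrib
          nat_mult_distrib algebra_simps)
    have close: "norm (x - y) \<le> real n / real M" if "x \<in> cell g" "y \<in> cell g" for x y g
    proof -
      have "\<bar>(x - y) $ k\<bar> \<le> 1 / real M" for k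
      proof (cases "k \<in> J")
        case True
        then have "\<lfloor>real M * x $ k\<rfloor> = \<lfloor>real M * y $ k\<rfloor>" using that by (auto simp: cell_def)
        then have "\<bar>real M * x $ k - real M * y $ k\<bar> \<le> 1" by linarith
        then have "real M * \<bar>x $ k - y $ k\<bar> \<le> 1"
          by (simp add: right_diff_distrib[symmetric] abs_mult)
        then show ?thesis using M by (simp add: field_simps)
      qed (use that M in \<open>auto simp: cell_def J_def\<close>)
      then have "(\<Sum>k\<in>UNIV. \<bar>(x - y) $ k\<bar>) \<le> of_nat (card (UNIV :: 'n set)) * (1 / real M)"
        by (intro sum_bounded_above) auto
      then show ?thesis using norm_le_l1_cart[of "x - y"] by (simp add: n_def)
    qed
    have bounded: "bounded (cell g)" for g
      unfolding bounded_two_points dist_norm using close by blast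
    have diam: "diameter (cell g) \<le> real n / real M" for g
      using close by (intro diameter_le) auto
    have "?L \<subseteq> (\<Union>g\<in>I. cell g)"
    proof
      fix y assume y: "y \<in> ?L"
      define g where "g = restrict (\<lambda>k. \<lfloor>real M * y $ k\<rfloor>) J"
      have "- int (R * M) \<le> \<lfloor>real M * y $ k\<rfloor> \<and> \<lfloor>real M * y $ k\<rfloor> \<le> int (R * M)" for k
      proof -
        have "\<bar>real M * y $ k\<bar> \<le> real M * real R"
          using y by (auto simp: abs_mult intro: mult_left_mono)
        then have "- real (R * M) \<le> real M * y $ k" "real M * y $ k \<le> real (R * M)"
          by (auto simp: mult.commute)
        then show ?thesis by (simp add: le_floor_iff floor_le_iff)
      qed
      then have "g \<in> I" by (auto simp: g_def I_def)
      moreover have "y \<in> cell g" using y by (auto simp: cell_def g_def)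
      ultimately show "y \<in> (\<Union>g\<in>I. cell g)" by blast
    qed
    then have "hausdorff_premeasure ?m \<delta> ?L \<le> (\<Sum>g\<in>I. hausdorff_weight ?m (cell g))"
      by (intro hausdorff_premeasure_le_finite_sum \<open>finite I\<close> less_imp_le[OF \<open>\<delta> > 0\<close>] conjI bounded
          order_trans[OF diam M(2)])
    also have "\<dots> \<le> (\<Sum>g\<in>I. ennreal (unit_ball_vol (real ?m) * (real n / real M / 2) ^ ?m))"
      using diam diameter_ge_0[OF bounded]
      by (intro sum_mono) (auto simp: hausdorff_weight_def intro!: ennreal_leI mult_left_mono
          power_mono divide_right_mono less_imp_le[OF unit_ball_vol_pos])
    also have "\<dots> = ennreal (real ((2 * R * M + 1) ^ (n - 2)) *
        (unit_ball_vol (real ?m) * (real n / real M / 2) ^ ?m))"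
      by (simp add: cardI ennreal_mult ennreal_of_nat_eq_real_of_nat less_imp_le[OF unit_ball_vol_pos])
    also have "\<dots> \<le> ennreal (c / real M)"
    proof (rule ennreal_leI)
      have "real (2 * R * M + 1) \<le> real (2 * R + 1) * real M"
        using M by (simp add: algebra_simps)
      then have "real ((2 * R * M + 1) ^ (n - 2)) \<le> (real (2 * R + 1) * real M) ^ (n - 2)"
        unfolding of_nat_power by (rule power_mono) simp
      then have "real ((2 * R * M + 1) ^ (n - 2)) *
          (unit_ball_vol (real ?m) * (real n / real M / 2) ^ ?m)
        \<le> (real (2 * R + 1) * real M) ^ (n - 2) *
          (unit_ball_vol (real ?m) * (real n / real M / 2) ^ ?m)"
        by (rule mult_right_mono) (simp add: less_imp_le[OF unit_ball_vol_pos])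
      also have "\<dots> = c * (real M ^ (n - 2) / real M ^ (n - 1))"
        by (simp add: c_def n_def[symmetric] power_mult_distrib power_divide mult_ac)
      also have "real M ^ (n - 2) / real M ^ (n - 1) = 1 / real M"
      proof -
        have "n - 1 = Suc (n - 2)" using n2 by simp
        then show ?thesis using M by simp
      qed
      finally show "real ((2 * R * M + 1) ^ (n - 2)) *
          (unit_ball_vol (real ?m) * (real n / real M / 2) ^ ?m) \<le> c / real M" by simp
    qed
    finally show ?thesis .
  qed
  have "hausdorff_premeasure ?m \<delta> ?L \<le> 0 + ennreal e" if "e > 0" for e :: real
  proof -
    obtain M :: nat where M: "real M \<ge> max 1 (max (real n / \<delta>) (c / e))"
      using real_arch_simple by blast
    then have "M \<ge> 1" "real n / real M \<le> \<delta>" "c / real M \<le> e"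
      using \<open>\<delta> > 0\<close> \<open>e > 0\<close> by (auto simp: field_simps)
    with key[of M] show ?thesis by (auto intro: order_trans ennreal_leI)
  qed
  then have "hausdorff_premeasure ?m \<delta> ?L \<le> 0" by (rule ennreal_le_epsilon)
  then show "hausdorff_premeasure ?m \<delta> ?L = 0" by simp
qed

lemma hausdorff_null_codim_2:
  fixes i j :: "'n::finite"
  assumes "i \<noteq> j"
  shows "hausdorff_measure (CARD('n) - 1) {y :: real ^ 'n. y $ i = r \<and> y $ j = s} = 0"
proof (rule hausdorff_null_subset)
  show "{y :: real ^ 'n. y $ i = r \<and> y $ j = s} \<subseteq>
      (\<Union>R. {y. y $ i = r \<and> y $ j = s \<and> (\<forall>k. \<bar>y $ k\<bar> \<le> real R)})"
  proof
    fix y :: "real ^ 'n" assume y: "y \<in> {y. y $ i = r \<and> y $ j = s}"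
    obtain R :: nat where "norm y \<le> real R" using real_arch_simple by blast
    then have "\<forall>k. \<bar>y $ k\<bar> \<le> real R" using component_le_norm_cart order_trans by blast
    then show "y \<in> (\<Union>R. {y. y $ i = r \<and> y $ j = s \<and> (\<forall>k. \<bar>y $ k\<bar> \<le> real R)})"
      using y by blast
  qed
  show "hausdorff_measure (CARD('n) - 1)
      (\<Union>R. {y :: real ^ 'n. y $ i = r \<and> y $ j = s \<and> (\<forall>k. \<bar>y $ k\<bar> \<le> real R)}) = 0"
    by (rule hausdorff_null_UN_nat[OF hausdorff_null_bounded_codim_2[OF assms]])
qed

section \<open>Singular boundary points\<close>

definition outer_normal :: "'a::real_inner set \<Rightarrow> 'a \<Rightarrow> 'a \<Rightarrow> bool" where
  "outer_normal K x u \<longleftrightarrow> (\<forall>z\<in>K. z \<bullet> u \<le> x \<bullet> u)"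

definition singular_points :: "'a::real_inner set \<Rightarrow> 'a set" where
  "singular_points K =
     {x \<in> K. \<exists>u\<in>sphere 0 1. \<exists>v\<in>sphere 0 1. u \<noteq> v \<and> outer_normal K x u \<and> outer_normal K x v}"

lemma outer_normal_cone:
  assumes "outer_normal K x u" "outer_normal K x v" "\<alpha> \<ge> 0" "\<beta> \<ge> 0"
  shows "outer_normal K x (\<alpha> *\<^sub>R u + \<beta> *\<^sub>R v)"
  using assms by (auto simp: outer_normal_def inner_add_right intro!: add_mono mult_left_mono)

lemma closest_point_add_outer_normal:
  fixes K :: "'a::euclidean_space set"
  assumes "convex K" "closed K" "x \<in> K" "outer_normal K x w"
  shows "closest_point K (x + w) = x"
proof (rule closest_point_unique[symmetric, OF assms(1-3)], rule ballI)
  fix z assume "z \<in> K"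
  then have "0 \<le> w \<bullet> (x - z)"
    using assms(4) by (simp add: outer_normal_def inner_diff_right inner_commute[of w])
  then have "(norm w)\<^sup>2 \<le> (norm (w + (x - z)))\<^sup>2"
    by (simp add: power2_norm_eq_inner inner_add_left inner_add_right inner_commute)
  then have "norm w \<le> norm (w + (x - z))" by (rule power2_le_imp_le) simp
  then show "dist (x + w) x \<le> dist (x + w) z" by (simp add: dist_norm algebra_simps)
qed

text \<open>Two opposite normals at one point confine \<open>K\<close> to a hyperplane.\<close>

lemma outer_normals_not_opposite:
  fixes K :: "'a::euclidean_space set"
  assumes "interior K \<noteq> {}" "u \<noteq> 0" "outer_normal K x u"
  shows "\<not> outer_normal K x (- u)"
proof
  assume "outer_normal K x (- u)"
  with assms(3) have "K \<subseteq> {z. u \<bullet> z = u \<bullet> x}"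
    by (force simp: outer_normal_def inner_commute)
  then have "interior K \<subseteq> interior {z. u \<bullet> z = u \<bullet> x}" by (rule interior_mono)
  then show False using assms(1,2) by simp
qed

lemma nonparallel_imp_minor_nonzero:
  fixes u v :: "real ^ 'n"
  assumes "norm u = 1" "norm v = 1" "v \<noteq> u" "v \<noteq> - u"
  obtains i j where "u $ i * v $ j - u $ j * v $ i \<noteq> 0"
proof (rule ccontr)
  assume "\<not> thesis"
  then have minors: "u $ i * v $ j = u $ j * v $ i" for i j using that by force
  have "u \<noteq> 0" using assms(1) by auto
  then obtain i where i: "u $ i \<noteq> 0" by (auto simp: vec_eq_iff)
  have v: "v = (v $ i / u $ i) *\<^sub>R u"
    using minors i by (auto simp: vec_eq_iff field_simps)
  have "norm v = \<bar>v $ i / u $ i\<bar> * norm u"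
    using arg_cong[OF v, of norm] unfolding norm_scaleR .
  then have "\<bar>v $ i / u $ i\<bar> = 1" unfolding assms(1,2) by (simp only: mult_1_right)
  then have "v $ i / u $ i = 1 \<or> v $ i / u $ i = - 1" by linarith
  with v show False using assms(3,4) by (metis scaleR_minus1_left scaleR_one)
qed

text \<open>
  Solving \<open>(x + \<alpha> u + \<beta> v)\<^sub>i = r\<close>, \<open>(x + \<alpha> u + \<beta> v)\<^sub>j = s\<close> for \<open>\<alpha>\<close> and \<open>\<beta>\<close> by Cramer's rule gives
  continuous functions of \<open>(r, s)\<close>. Both are positive on a nonempty open set of pairs, since
  \<open>\<alpha> = \<beta> = 1\<close> is attained, and this open set meets the countable dense set \<open>D\<close>.
\<close>

lemma singular_points_subset_images_of_planes:
  fixes K :: "(real ^ 'n) set"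
  assumes "convex_body K" and D: "\<And>X :: (real \<times> real) set. open X \<Longrightarrow> X \<noteq> {} \<Longrightarrow> \<exists>d\<in>D. d \<in> X"
  shows "singular_points K \<subseteq>
    (\<Union>(i, j, r, s) \<in> {(i, j, r, s). i \<noteq> j \<and> (r, s) \<in> D}.
       closest_point K ` {y. y $ i = r \<and> y $ j = s})"
proof
  fix x assume "x \<in> singular_points K"
  then obtain u v where x: "x \<in> K" and u: "norm u = 1" "outer_normal K x u"
    and v: "norm v = 1" "outer_normal K x v" and "v \<noteq> u"
    by (auto simp: singular_points_def)
  have "u \<noteq> 0" using u by auto
  then have "v \<noteq> - u"
    using outer_normals_not_opposite[of K u x] assms(1) u v by (auto simp: convex_body_def)
  then obtain i j where minor: "u $ i * v $ j - u $ j * v $ i \<noteq> 0"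
    using nonparallel_imp_minor_nonzero u(1) v(1) \<open>v \<noteq> u\<close> by metis
  define \<Delta> where "\<Delta> = u $ i * v $ j - u $ j * v $ i"
  have "\<Delta> \<noteq> 0" using minor by (simp add: \<Delta>_def)
  define \<alpha> where "\<alpha> q = ((fst q - x $ i) * v $ j - (snd q - x $ j) * v $ i) / \<Delta>" for q
  define \<beta> where "\<beta> q = ((snd q - x $ j) * u $ i - (fst q - x $ i) * u $ j) / \<Delta>" for q
  define X where "X = {q. 0 < \<alpha> q} \<inter> {q. 0 < \<beta> q}"
  have "open X"
    unfolding X_def \<alpha>_def \<beta>_def using \<open>\<Delta> \<noteq> 0\<close>
    by (intro open_Int open_Collect_less continuous_intros) auto
  moreover have "(x $ i + u $ i + v $ i, x $ j + u $ j + v $ j) \<in> X"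
  proof -
    have "\<alpha> (x $ i + u $ i + v $ i, x $ j + u $ j + v $ j) = \<Delta> / \<Delta>"
      "\<beta> (x $ i + u $ i + v $ i, x $ j + u $ j + v $ j) = \<Delta> / \<Delta>"
      by (simp_all add: \<alpha>_def \<beta>_def \<Delta>_def algebra_simps)
    then show ?thesis using \<open>\<Delta> \<noteq> 0\<close> by (simp add: X_def)
  qed
  ultimately obtain q where q: "q \<in> D" "q \<in> X" using D by blast
  define w where "w = \<alpha> q *\<^sub>R u + \<beta> q *\<^sub>R v"
  have "outer_normal K x w"
    unfolding w_def using q u v by (intro outer_normal_cone) (auto simp: X_def)
  then have "closest_point K (x + w) = x"
    using assms(1) x by (intro closest_point_add_outer_normal)
      (auto simp: convex_body_def compact_imp_closed)
  moreover have "(x + w) $ i = fst q" "(x + w) $ j = snd q"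
  proof -
    have "w $ i = (fst q - x $ i) * \<Delta> / \<Delta>" "w $ j = (snd q - x $ j) * \<Delta> / \<Delta>"
      by (simp_all add: w_def \<alpha>_def \<beta>_def add_divide_distrib[symmetric] \<Delta>_def algebra_simps)
    then show "(x + w) $ i = fst q" "(x + w) $ j = snd q" using \<open>\<Delta> \<noteq> 0\<close> by simp_all
  qed
  moreover have "i \<noteq> j" using minor by auto
  ultimately show "x \<in> (\<Union>(i, j, r, s) \<in> {(i, j, r, s). i \<noteq> j \<and> (r, s) \<in> D}.
       closest_point K ` {y. y $ i = r \<and> y $ j = s})"
    using q(1) by (intro UN_I[of "(i, j, fst q, snd q)"]) (auto intro!: image_eqI[of x _ "x + w"])
qed

lemma hausdorff_null_singular_points:
  fixes K :: "(real ^ 'n) set"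
  assumes "convex_body K"
  shows "hausdorff_measure (CARD('n) - 1) (singular_points K) = 0"
proof -
  obtain D :: "(real \<times> real) set" where "countable D"
    and D: "\<And>X. open X \<Longrightarrow> X \<noteq> {} \<Longrightarrow> \<exists>d\<in>D. d \<in> X"
    by (rule countable_dense_setE) blast
  define I where "I = {(i :: 'n, j :: 'n, r, s). i \<noteq> j \<and> (r, s) \<in> D}"
  have "I \<subseteq> UNIV \<times> UNIV \<times> D" by (auto simp: I_def)
  then have "countable I"
    by (rule countable_subset) (intro countable_SIGMA \<open>countable D\<close> countable_finite finite)
  have K: "convex K" "closed K" "K \<noteq> {}"
    using assms by (auto simp: convex_body_def compact_imp_closed)
  have "hausdorff_measure (CARD('n) - 1)
      (\<Union>(i, j, r, s)\<in>I. closest_point K ` {y. y $ i = r \<and> y $ j = s}) = 0"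
  proof (rule hausdorff_null_UN[OF \<open>countable I\<close>])
    fix t assume "t \<in> I"
    then show "hausdorff_measure (CARD('n) - 1)
        (case t of (i, j, r, s) \<Rightarrow> closest_point K ` {y. y $ i = r \<and> y $ j = s}) = 0"
      by (auto simp: I_def intro!: hausdorff_null_nonexpansive_image
          closest_point_lipschitz[OF K]
          hausdorff_null_codim_2[simplified])
  qed
  moreover have "singular_points K \<subseteq>
      (\<Union>(i, j, r, s)\<in>I. closest_point K ` {y. y $ i = r \<and> y $ j = s})"
    unfolding I_def by (rule singular_points_subset_images_of_planes[OF assms]) (rule D)
  ultimately show ?thesis by (rule hausdorff_null_subset[rotated])
qed

section \<open>Support functions of Wulff shapes\<close>

lemma bdd_above_inner_image:
  assumes "bounded K"
  shows "bdd_above ((\<lambda>x. x \<bullet> u) ` K)"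
proof -
  obtain B where "\<And>x. x \<in> K \<Longrightarrow> norm x \<le> B" using assms by (auto simp: bounded_iff)
  then have "x \<bullet> u \<le> B * norm u" if "x \<in> K" for x
    using that norm_cauchy_schwarz[of x u] by (meson mult_right_mono norm_ge_zero order_trans)
  then show ?thesis by (auto intro!: bdd_aboveI)
qed

lemma inner_le_support_function:
  "bounded K \<Longrightarrow> x \<in> K \<Longrightarrow> x \<bullet> u \<le> support_function K u"
  unfolding support_function_def by (rule cSUP_upper[OF _ bdd_above_inner_image])

lemma continuous_on_support_function:
  fixes K :: "'a::euclidean_space set"
  assumes "bounded K"
  shows "continuous_on S (support_function K)"
proof (cases "K = {}")
  case True
  then show ?thesis by (simp add: support_function_def[abs_def])
next
  case False
  obtain B where "B > 0" and B: "\<And>x. x \<in> K \<Longrightarrow> norm x \<le> B"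
    using assms by (auto simp: bounded_pos)
  have le: "support_function K u \<le> support_function K v + B * dist u v" for u v
    unfolding support_function_def[of K u]
  proof (rule cSUP_least[OF False])
    fix x assume x: "x \<in> K"
    have "x \<bullet> u = x \<bullet> v + x \<bullet> (u - v)" by (simp add: inner_diff_right)
    also have "x \<bullet> (u - v) \<le> B * dist u v"
      using norm_cauchy_schwarz[of x "u - v"] B[OF x]
      by (smt (verit) dist_norm mult_right_mono norm_ge_zero)
    finally show "x \<bullet> u \<le> support_function K v + B * dist u v"
      using inner_le_support_function[OF assms x, of v] by linarith
  qed
  show ?thesis
    unfolding continuous_on_iff
  proof (intro ballI allI impI)
    fix u and e :: real assume "e > 0"
    have "dist (support_function K v) (support_function K u) < e" if "dist v u < e / B" for v
    proof -
      have "B * dist v u < e" using that \<open>B > 0\<close> by (simp add: field_simps)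
      then show ?thesis
        using le[of u v] le[of v u] by (auto simp: dist_real_def dist_commute abs_less_iff)
    qed
    then show "\<exists>d>0. \<forall>v\<in>S. dist v u < d \<longrightarrow> dist (support_function K v) (support_function K u) < e"
      using \<open>e > 0\<close> \<open>B > 0\<close> by (intro exI[of _ "e / B"]) auto
  qed
qed

lemma support_function_wulff_le:
  assumes "wulff_shape g \<noteq> {}" "u \<in> sphere 0 1"
  shows "support_function (wulff_shape g) u \<le> g u"
  unfolding support_function_def using assms by (intro cSUP_least) (auto simp: wulff_shape_def)

lemma inner_le_support_function_wulff:
  assumes "y \<in> wulff_shape g" "u \<in> sphere 0 1"
  shows "y \<bullet> u \<le> support_function (wulff_shape g) u"
  unfolding support_function_def using assms
  by (intro cSUP_upper) (auto simp: wulff_shape_def intro!: bdd_aboveI[of _ "g u"])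

lemma bounded_wulff_shape:
  fixes g :: "'a::euclidean_space \<Rightarrow> real"
  assumes "continuous_on (sphere 0 1) g"
  shows "bounded (wulff_shape g)"
proof -
  have "bounded (g ` sphere 0 1)"
    using assms by (intro compact_imp_bounded compact_continuous_image) auto
  then obtain B where B: "\<And>u. u \<in> sphere 0 1 \<Longrightarrow> \<bar>g u\<bar> \<le> B" unfolding bounded_iff by (metis imageI real_norm_def)
  have "norm x \<le> max B 0" if "x \<in> wulff_shape g" for x
  proof (cases "x = 0")
    case False
    have u: "sgn x \<in> sphere 0 1" using False by (simp add: norm_sgn)
    have "norm x = x \<bullet> sgn x"
      using False by (simp add: sgn_div_norm power2_norm_eq_inner[symmetric] power2_eq_square)
    also have "\<dots> \<le> g (sgn x)" using that u by (auto simp: wulff_shape_def)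
    finally show ?thesis using B[OF u] by linarith
  qed simp
  then show ?thesis by (auto simp: bounded_iff)
qed

text \<open>
  The point \<open>x\<close> moved along \<open>u\<close> by slightly less than \<open>t f(u)\<close> stays in the perturbed body.
  For \<open>v\<close> in the set \<open>C\<close> below, which is compact and does not contain \<open>u\<close>, the slack
  \<open>h\<^sub>K(v) - x \<bullet> v\<close> has a positive minimum because \<open>u\<close> is the only normal at \<open>x\<close>. Outside \<open>C\<close> the
  term \<open>e \<bar>t\<bar> (u \<bullet> v)\<close> dominates \<open>\<bar>t\<bar> \<bar>f(v) - f(u) (u \<bullet> v)\<bar>\<close> by definition.
\<close>

lemma shifted_regular_point_in_wulff:
  fixes K :: "'a::euclidean_space set"
  assumes K: "compact K" and f: "continuous_on (sphere 0 1) f"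
    and x: "x \<in> K" and u: "u \<in> sphere 0 1"
    and unique: "\<And>v. v \<in> sphere 0 1 \<Longrightarrow> outer_normal K x v \<Longrightarrow> v = u"
    and "e > 0"
  obtains d where "d > 0"
    "\<And>t. \<bar>t\<bar> < d \<Longrightarrow>
       x + (t * f u - e * \<bar>t\<bar>) *\<^sub>R u \<in> wulff_shape (\<lambda>v. support_function K v + t * f v)"
proof -
  define G where "G v = support_function K v - x \<bullet> v" for v
  define H where "H v = f v - f u * (u \<bullet> v)" for v
  define C where "C = {v \<in> sphere 0 1. e * (u \<bullet> v) \<le> \<bar>H v\<bar>}"
  have bdd: "bounded K" using K by (rule compact_imp_bounded)
  have contG: "continuous_on S G" for S
    unfolding G_def by (intro continuous_intros continuous_on_support_function bdd)
  have contH: "continuous_on (sphere 0 1) H"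
    unfolding H_def by (intro continuous_intros f)
  have G0: "G v \<ge> 0" for v
    using inner_le_support_function[OF bdd x] by (simp add: G_def)
  have "u \<bullet> u = 1" using u by (simp add: dot_square_norm)
  have Gpos: "G v > 0" if "v \<in> C" for v
  proof (rule ccontr)
    assume "\<not> G v > 0"
    then have "outer_normal K x v"
      using inner_le_support_function[OF bdd, of _ v]
      by (force simp: outer_normal_def G_def)
    then have "v = u" using unique that by (simp add: C_def)
    then show False using that \<open>e > 0\<close> \<open>u \<bullet> u = 1\<close> by (simp add: C_def H_def)
  qed
  have "closed C"
    unfolding C_def by (intro continuous_on_closed_Collect_le continuous_intros contH) auto
  then have "compact C"
    using compact_Int_closed[OF compact_sphere, of C 0 1] by (simp add: C_def Int_def)
  have "\<exists>c>0. \<forall>v\<in>C. c \<le> G v"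
  proof (cases "C = {}")
    case False
    then obtain w where "w \<in> C" "\<forall>v\<in>C. G w \<le> G v"
      using continuous_attains_inf[OF \<open>compact C\<close> False contG] by blast
    then show ?thesis using Gpos by blast
  qed (auto intro: exI[of _ 1])
  then obtain c where "c > 0" and c: "\<And>v. v \<in> C \<Longrightarrow> c \<le> G v" by blast
  have "bounded (H ` sphere 0 1)"
    using contH by (intro compact_imp_bounded compact_continuous_image) auto
  then obtain B where "B > 0" and B: "\<And>v. v \<in> sphere 0 1 \<Longrightarrow> \<bar>H v\<bar> \<le> B"
    by (auto simp: bounded_pos)
  show thesis
  proof
    show "c / (B + e) > 0" using \<open>c > 0\<close> \<open>B > 0\<close> \<open>e > 0\<close> by simp
    fix t :: real assume t: "\<bar>t\<bar> < c / (B + e)"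
    show "x + (t * f u - e * \<bar>t\<bar>) *\<^sub>R u \<in> wulff_shape (\<lambda>v. support_function K v + t * f v)"
      unfolding wulff_shape_def
    proof (intro INT_I CollectI)
      fix v :: 'a assume v: "v \<in> sphere 0 1"
      have tH: "- (\<bar>t\<bar> * \<bar>H v\<bar>) \<le> t * H v"
        by (metis abs_ge_minus_self abs_mult minus_le_iff)
      have "0 \<le> G v + t * H v + \<bar>t\<bar> * (e * (u \<bullet> v))"
      proof (cases "v \<in> C")
        case True
        have "\<bar>u \<bullet> v\<bar> \<le> 1" using Cauchy_Schwarz_ineq2[of u v] u v by simp
        then have "- (\<bar>t\<bar> * e) \<le> \<bar>t\<bar> * (e * (u \<bullet> v))"
          using \<open>e > 0\<close> mult_left_mono[of "-1" "u \<bullet> v" "\<bar>t\<bar> * e"] by (simp add: mult.assoc)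
        moreover have "\<bar>t\<bar> * \<bar>H v\<bar> \<le> \<bar>t\<bar> * B" using B[OF v] by (rule mult_left_mono) simp
        moreover have "\<bar>t\<bar> * (B + e) < c"
          using t \<open>B > 0\<close> \<open>e > 0\<close> by (simp add: field_simps)
        ultimately show ?thesis using c[OF True] tH by (simp add: distrib_left)
      next
        case False
        then have "\<bar>H v\<bar> \<le> e * (u \<bullet> v)" using v by (simp add: C_def)
        then have "\<bar>t\<bar> * \<bar>H v\<bar> \<le> \<bar>t\<bar> * (e * (u \<bullet> v))" by (rule mult_left_mono) simp
        then show ?thesis using G0[of v] tH by linarith
      qed
      then show "(x + (t * f u - e * \<bar>t\<bar>) *\<^sub>R u) \<bullet> v \<le> support_function K v + t * f v"
        by (simp add: G_def H_def inner_add_left algebra_simps)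
    qed
  qed
qed

lemma has_real_derivative_at_0_iff:
  fixes \<phi> :: "real \<Rightarrow> real"
  shows "(\<phi> has_real_derivative D) (at 0) \<longleftrightarrow>
    (\<forall>e>0. \<exists>d>0. \<forall>t. \<bar>t\<bar> < d \<longrightarrow> \<bar>\<phi> t - \<phi> 0 - D * t\<bar> \<le> e * \<bar>t\<bar>)"
  unfolding has_field_derivative_def has_derivative_at_alt
  by (simp add: bounded_linear_mult_right)

text \<open>
  The point of \<open>shifted_regular_point_in_wulff\<close> gives the lower bound, the definition of the Wulff
  shape the upper one. For \<open>t = 0\<close> the two bounds coincide and show that the value there is \<open>h\<^sub>K(u)\<close>.
\<close>

lemma has_derivative_support_wulff_at_regular_normal:
  fixes K :: "'a::euclidean_space set"
  assumes K: "compact K" and f: "continuous_on (sphere 0 1) f"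
    and x: "x \<in> K" and u: "u \<in> sphere 0 1" "x \<bullet> u = support_function K u"
    and unique: "\<And>v. v \<in> sphere 0 1 \<Longrightarrow> outer_normal K x v \<Longrightarrow> v = u"
  shows "((\<lambda>t. support_function (wulff_shape (\<lambda>v. support_function K v + t * f v)) u)
       has_real_derivative f u) (at 0)"
proof -
  define W where "W t = wulff_shape (\<lambda>v. support_function K v + t * f v)" for t
  have "u \<bullet> u = 1" using u(1) by (simp add: dot_square_norm)
  have bounds: "\<exists>d>0. \<forall>t. \<bar>t\<bar> < d \<longrightarrow>
      support_function K u + t * f u - e * \<bar>t\<bar> \<le> support_function (W t) u \<and>
      support_function (W t) u \<le> support_function K u + t * f u" if "e > 0" for e
  proof -
    obtain d where "d > 0" and d: "\<And>t. \<bar>t\<bar> < d \<Longrightarrow> x + (t * f u - e * \<bar>t\<bar>) *\<^sub>R u \<in> W t"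
      using shifted_regular_point_in_wulff[OF K f x u(1) unique \<open>e > 0\<close>] unfolding W_def by metis
    have "support_function K u + t * f u - e * \<bar>t\<bar> \<le> support_function (W t) u \<and>
      support_function (W t) u \<le> support_function K u + t * f u" if "\<bar>t\<bar> < d" for t
    proof
      have "(x + (t * f u - e * \<bar>t\<bar>) *\<^sub>R u) \<bullet> u \<le> support_function (W t) u"
        using inner_le_support_function_wulff[OF d[OF that, unfolded W_def] u(1)]
        by (simp add: W_def)
      then show "support_function K u + t * f u - e * \<bar>t\<bar> \<le> support_function (W t) u"
        using u(2) \<open>u \<bullet> u = 1\<close> by (simp add: inner_add_left)
      show "support_function (W t) u \<le> support_function K u + t * f u"
        unfolding W_def by (rule support_function_wulff_le) (use d[OF that] u(1) in \<open>auto simp: W_def\<close>)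
    qed
    then show ?thesis using \<open>d > 0\<close> by blast
  qed
  have at0: "support_function (W 0) u = support_function K u"
  proof -
    obtain d where "d > 0" and d: "\<And>t. \<bar>t\<bar> < d \<Longrightarrow>
        support_function K u + t * f u - 1 * \<bar>t\<bar> \<le> support_function (W t) u \<and>
        support_function (W t) u \<le> support_function K u + t * f u"
      using bounds[OF zero_less_one] by blast
    then show ?thesis using d[of 0] by simp
  qed
  show ?thesis
    unfolding has_real_derivative_at_0_iff W_def[symmetric] at0
  proof (intro allI impI)
    fix e :: real assume "e > 0"
    then obtain d where "d > 0" and d: "\<And>t. \<bar>t\<bar> < d \<Longrightarrow>
        support_function K u + t * f u - e * \<bar>t\<bar> \<le> support_function (W t) u \<and>
        support_function (W t) u \<le> support_function K u + t * f u"
      using bounds by blast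
    have "\<bar>support_function (W t) u - support_function K u - f u * t\<bar> \<le> e * \<bar>t\<bar>" if "\<bar>t\<bar> < d" for t
    proof -
      have "0 \<le> e * \<bar>t\<bar>" using \<open>e > 0\<close> by simp
      then show ?thesis using d[OF that] by (simp add: abs_le_iff mult.commute[of "f u"])
    qed
    then show "\<exists>d>0. \<forall>t. \<bar>t\<bar> < d \<longrightarrow>
        \<bar>support_function (W t) u - support_function K u - f u * t\<bar> \<le> e * \<bar>t\<bar>"
      using \<open>d > 0\<close> by blast
  qed
qed

section \<open>Exceptional directions\<close>

text \<open>
  In the definition of the derivative the quantifiers over \<open>e\<close> and \<open>d\<close> may be restricted to
  \<open>1 / (k + 1)\<close>, while the one over \<open>t\<close> stays uncountable: it produces an intersection of closed sets.
\<close>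

lemma borel_derivative_directions:
  fixes \<phi> :: "real \<Rightarrow> 'a::euclidean_space \<Rightarrow> real"
  assumes \<phi>: "\<And>t. continuous_on S (\<phi> t)" and f: "continuous_on S f" and "closed S"
  shows "{u \<in> S. ((\<lambda>t. \<phi> t u) has_real_derivative f u) (at 0)} \<in> sets borel"
proof -
  define E where "E k t = {u \<in> S. \<bar>\<phi> t u - \<phi> 0 u - f u * t\<bar> \<le> 1 / real (Suc k) * \<bar>t\<bar>}" for k t
  have "closed (E k t)" for k t
    unfolding E_def using \<open>closed S\<close>
    by (rule continuous_on_closed_Collect_le[rotated 2]) (intro continuous_intros \<phi> f)+
  then have "closed (S \<inter> (\<Inter>t\<in>{t. \<bar>t\<bar> < 1 / real (Suc l)}. E k t))" for k l
    using \<open>closed S\<close> by (intro closed_Int closed_INT) auto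
  then have "S \<inter> (\<Inter>t\<in>{t. \<bar>t\<bar> < 1 / real (Suc l)}. E k t) \<in> sets borel" for k l
    by (rule borel_closed)
  then have "(\<Inter>k. \<Union>l. S \<inter> (\<Inter>t\<in>{t. \<bar>t\<bar> < 1 / real (Suc l)}. E k t)) \<in> sets borel"
    by (intro sets.countable_INT sets.countable_UN image_subsetI) simp_all
  also have "(\<Inter>k. \<Union>l. S \<inter> (\<Inter>t\<in>{t. \<bar>t\<bar> < 1 / real (Suc l)}. E k t)) =
      {u \<in> S. ((\<lambda>t. \<phi> t u) has_real_derivative f u) (at 0)}" (is "?L = ?R")
  proof
    show "?L \<subseteq> ?R"
    proof
      fix u assume u: "u \<in> ?L"
      have "\<exists>d>0. \<forall>t. \<bar>t\<bar> < d \<longrightarrow> \<bar>\<phi> t u - \<phi> 0 u - f u * t\<bar> \<le> e * \<bar>t\<bar>" if "e > 0" for e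
      proof -
        obtain k where k: "1 / real (Suc k) < e"
          using nat_approx_posE[OF \<open>e > 0\<close>] by blast
        have "u \<in> (\<Union>l. S \<inter> (\<Inter>t\<in>{t. \<bar>t\<bar> < 1 / real (Suc l)}. E k t))"
          using u by (rule INT_D) simp
        then obtain l where l: "\<And>t. \<bar>t\<bar> < 1 / real (Suc l) \<Longrightarrow> u \<in> E k t" by auto
        have "\<bar>\<phi> t u - \<phi> 0 u - f u * t\<bar> \<le> e * \<bar>t\<bar>" if "\<bar>t\<bar> < 1 / real (Suc l)" for t
        proof (rule order_trans)
          show "\<bar>\<phi> t u - \<phi> 0 u - f u * t\<bar> \<le> 1 / real (Suc k) * \<bar>t\<bar>"
            using l[OF that] by (simp add: E_def)
          show "1 / real (Suc k) * \<bar>t\<bar> \<le> e * \<bar>t\<bar>"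
            using k by (intro mult_right_mono) auto
        qed
        then show ?thesis by (intro exI[of _ "1 / real (Suc l)"]) auto
      qed
      then show "u \<in> ?R" using u by (simp add: has_real_derivative_at_0_iff)
    qed
    show "?R \<subseteq> ?L"
    proof
      fix u assume u: "u \<in> ?R"
      have "\<exists>l. u \<in> S \<inter> (\<Inter>t\<in>{t. \<bar>t\<bar> < 1 / real (Suc l)}. E k t)" for k
      proof -
        have "1 / real (Suc k) > 0" by simp
        then obtain d where "d > 0" and d: "\<And>t. \<bar>t\<bar> < d \<Longrightarrow>
            \<bar>\<phi> t u - \<phi> 0 u - f u * t\<bar> \<le> 1 / real (Suc k) * \<bar>t\<bar>"
          using u unfolding has_real_derivative_at_0_iff by blast
        obtain l where "1 / real (Suc l) < d"
          using nat_approx_posE[OF \<open>d > 0\<close>] by blast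
        then show ?thesis using u d by (intro exI[of _ l]) (auto simp: E_def)
      qed
      then show "u \<in> ?L" by blast
    qed
  qed
  finally show ?thesis .
qed

text \<open>
  For the set of exceptional directions, \<open>measure_of\<close> yields either the value of the Hausdorff measure
  or \<open>0\<close>; both vanish.
\<close>

lemma AE_surface_area_measureI:
  fixes K :: "'a::euclidean_space set"
  assumes "{u \<in> sphere 0 1. P u} \<in> sets borel"
    and null: "hausdorff_measure (DIM('a) - 1)
      (reverse_spherical_image K {u \<in> sphere 0 1. \<not> P u}) = 0"
  shows "AE u in surface_area_measure K. P u"
proof (rule AE_I)
  let ?N = "{u \<in> sphere 0 1. \<not> P u}"
  show "{u \<in> space (surface_area_measure K). \<not> P u} \<subseteq> ?N" by simp
  have "?N = sphere 0 1 - {u \<in> sphere 0 1. P u}" by auto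
  also have "\<dots> \<in> sets borel" using assms(1) by auto
  finally show "?N \<in> sets (surface_area_measure K)"
    by (auto simp: sets_restrict_space_iff)
  show "emeasure (surface_area_measure K) ?N = 0"
    unfolding surface_area_measure_def
    by (subst emeasure_measure_of_conv) (use null in \<open>auto simp: sets_restrict_space\<close>)
qed

theorem theorem3p5:
  fixes K :: "(real ^ 'n) set" and f :: "real ^ 'n \<Rightarrow> real" and a b :: real
  assumes "convex_body K"
    and "0 \<in> interior K"
    and "continuous_on (sphere 0 1) f"
    and "a < 0" and "0 < b"
    and "\<And>t u. t \<in> {a<..<b} \<Longrightarrow> u \<in> sphere 0 1 \<Longrightarrow> support_function K u + t * f u > 0"
  shows "AE u in surface_area_measure K.
    ((\<lambda>t. support_function (wulff_shape (\<lambda>v. support_function K v + t * f v)) u)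
       has_real_derivative f u) (at 0)"
proof (rule AE_surface_area_measureI)
  define P where "P u \<longleftrightarrow>
    ((\<lambda>t. support_function (wulff_shape (\<lambda>v. support_function K v + t * f v)) u)
       has_real_derivative f u) (at 0)" for u
  have K: "compact K" "bounded K" "closed K"
    using assms(1) by (auto simp: convex_body_def compact_imp_bounded compact_imp_closed)
  have "continuous_on (sphere 0 1) (\<lambda>v. support_function K v + t * f v)" for t
    by (intro continuous_intros continuous_on_support_function K assms(3))
  then show "{u \<in> sphere 0 1. ((\<lambda>t. support_function
      (wulff_shape (\<lambda>v. support_function K v + t * f v)) u) has_real_derivative f u) (at 0)}
      \<in> sets borel"
    using assms(3)
    by (intro borel_derivative_directions continuous_on_support_function bounded_wulff_shape) auto
  have "reverse_spherical_image K {u \<in> sphere 0 1. \<not> P u} \<subseteq> singular_points K"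
  proof
    fix x assume "x \<in> reverse_spherical_image K {u \<in> sphere 0 1. \<not> P u}"
    then obtain u where x: "x \<in> frontier K" and u: "u \<in> sphere 0 1" "x \<bullet> u = support_function K u"
      and "\<not> P u"
      by (auto simp: reverse_spherical_image_def)
    have "x \<in> K" using x K(3) frontier_subset_closed by blast
    then obtain v where "v \<in> sphere 0 1" "outer_normal K x v" "v \<noteq> u"
      using has_derivative_support_wulff_at_regular_normal[OF K(1) assms(3) _ u] \<open>\<not> P u\<close>
      unfolding P_def by blast
    moreover have "outer_normal K x u"
      using inner_le_support_function[OF K(2)] u(2) by (simp add: outer_normal_def)
    ultimately show "x \<in> singular_points K"
      using \<open>x \<in> K\<close> u(1) unfolding singular_points_def by blast
  qed
  then have "hausdorff_measure (CARD('n) - 1)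
      (reverse_spherical_image K {u \<in> sphere 0 1. \<not> P u}) = 0"
    using hausdorff_null_singular_points[OF assms(1)] by (rule hausdorff_null_subset)
  then show "hausdorff_measure (DIM(real ^ 'n) - 1) (reverse_spherical_image K
      {u \<in> sphere 0 1. \<not> ((\<lambda>t. support_function
        (wulff_shape (\<lambda>v. support_function K v + t * f v)) u) has_real_derivative f u) (at 0)}) = 0"
    unfolding P_def by simp
qed

end
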